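(* Let $X$ be a finite set with $|X|=m$, let $\Gamma$ be an arbitrary hypergraph on $X$, and let $\mathcal{M}_\Gamma$ be the canonical matrix of $\Gamma$, a square matrix over the ring of partials $\Pi(X)$. Then, as subsets of the symmetric group $S_X$, $$\det(\mathcal{M}_\Gamma)=Aut(\Gamma).$$
   Context: A hypergraph $\Gamma$ on the finite set $X$, $|X|=m$, is a set of nonempty subsets (edges) of $X$. Its automorphism group is $Aut(\Gamma)=\{g\in S_X : g(A)\in\Gamma \text{ for all } A\in\Gamma\}$. For $1\le k\le m$, the $k$-section is $\Gamma_k=\{A\in\Gamma : |A|=k\}$, so $\Gamma=\bigsqcup_{k=1}^m\Gamma_k$. A partial $\pi$ on $X$ is an injective function from a subset of $X$ to $X$; its class is $[\pi]=\{g\in S_X : g \text{ restricts to } \pi \text{ on the domain of }\pi\}$. The ring of partials $\Pi(X)$ is the power set of $S_X$, with addition the symmetric difference and multiplication the intersection; it is a commutative $\mathbb{F}_2$-algebra with $0=\emptyset$ and $1=S_X$. A partial $\pi$ is identified with the element $[\pi]\in\Pi(X)$. For an $n\times n$ matrix $(a_{i,j})$ over $\Pi(X)$, the determinant is $\det((a_{i,j}))=\sum_{\rho\in \mathcal{S}_n}\prod_{i=1}^n a_{i,\rho(i)}\in\Pi(X)$, sum and product being those of $\Pi(X)$ (signs are irrelevant since $1=-1$; the empty determinant is $1$). For a $k$-homogeneous hypergraph $\{A_1,\dots,A_n\}$ (all edges have exactly $k$ elements), with $A_l=\{a_l^1,\dots,a_l^k\}$, the canonical matrix is the $n\times n$ matrix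 with $(i,j)$ entry $$\begin{pmatrix} A_i \\ {A_j} \end{pmatrix}=\sum_{\sigma\in \mathcal{S}_k}\begin{pmatrix} a_i^1&\cdots&a_i^k \\ {a_j^{\sigma(1)}}&\cdots&a_j^{\sigma(k)} \end{pmatrix}\in\Pi(X),$$ where the two-row array denotes the partial sending each upper entry to the entry below it. For an arbitrary hypergraph $\Gamma$, let $\mathcal{M}_k$ be the canonical matrix of the $k$-homogeneous hypergraph $\Gamma_k$ (an empty block if $\Gamma_k=\emptyset$); the canonical matrix $\mathcal{M}_\Gamma$ is the block-diagonal matrix with diagonal blocks $\mathcal{M}_1,\dots,\mathcal{M}_m$ and all other entries $0$. *)

theory Defs
  imports
    "HOL-Algebra.Ring"
    "HOL-Combinatorics.Permutations"
    "Jordan_Normal_Form.Matrix"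
begin

text \<open>The symmetric group on \<open>X\<close> is \<open>{g. g permutes X}\<close>: its elements are total functions that are
  the identity outside \<open>X\<close>.\<close>

definition hypergraph_on :: "'a set \<Rightarrow> 'a set set \<Rightarrow> bool" where
  "hypergraph_on X \<Gamma> \<longleftrightarrow> \<Gamma> \<subseteq> Pow X - {{}}"

definition hypergraph_aut :: "'a set \<Rightarrow> 'a set set \<Rightarrow> ('a \<Rightarrow> 'a) set" where
  "hypergraph_aut X \<Gamma> = {g. g permutes X \<and> (\<forall>A\<in>\<Gamma>. g ` A \<in> \<Gamma>)}"

definition k_section :: "'a set set \<Rightarrow> nat \<Rightarrow> 'a set set" where
  "k_section \<Gamma> k = {A \<in> \<Gamma>. card A = k}"


definition is_partial :: "'a set \<Rightarrow> ('a \<rightharpoonup> 'a) \<Rightarrow> bool" where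
  "is_partial X p \<longleftrightarrow> dom p \<subseteq> X \<and> ran p \<subseteq> X \<and> inj_on p (dom p)"

definition partial_class :: "'a set \<Rightarrow> ('a \<rightharpoonup> 'a) \<Rightarrow> ('a \<Rightarrow> 'a) set" where
  "partial_class X p = {g. g permutes X \<and> (\<forall>x\<in>dom p. p x = Some (g x))}"

definition partials_ring :: "'a set \<Rightarrow> ('a \<Rightarrow> 'a) set ring" where
  "partials_ring X =
     \<lparr>carrier = Pow {g. g permutes X}, mult = (\<inter>), one = {g. g permutes X},
      zero = {}, add = (\<lambda>A B. (A - B) \<union> (B - A))\<rparr>"

lemma cring_partials_ring: "cring (partials_ring X)"
proof (rule cringI)
  show "abelian_group (partials_ring X)"
  proof (rule abelian_groupI)
    fix A assume "A \<in> carrier (partials_ring X)"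
    then show "\<exists>B\<in>carrier (partials_ring X). B \<oplus>\<^bsub>partials_ring X\<^esub> A = \<zero>\<^bsub>partials_ring X\<^esub>"
      by (intro bexI[of _ A]) (auto simp: partials_ring_def)
  qed (auto simp: partials_ring_def)
  show "comm_monoid (partials_ring X)"
    by (rule comm_monoidI) (auto simp: partials_ring_def)
qed (auto simp: partials_ring_def)


text \<open>The Leibniz formula without signs, since \<open>1 = -1\<close> in the ring of partials.\<close>

definition partials_det :: "'a set \<Rightarrow> ('a \<Rightarrow> 'a) set mat \<Rightarrow> ('a \<Rightarrow> 'a) set" where
  "partials_det X M =
     (\<Oplus>\<^bsub>partials_ring X\<^esub> \<rho> \<in> {\<rho>. \<rho> permutes {..<dim_row M}}.
        \<Otimes>\<^bsub>partials_ring X\<^esub> i \<in> {..<dim_row M}. M $$ (i, \<rho> i))"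

text \<open>This is \<^const>\<open>diag_block_mat\<close> with the zero of a ring record in place of that of a type class.\<close>

fun block_diag :: "('b, 'c) ring_scheme \<Rightarrow> 'b mat list \<Rightarrow> 'b mat" where
  "block_diag R [] = mat 0 0 (\<lambda>_. \<zero>\<^bsub>R\<^esub>)"
| "block_diag R (A # As) = (let B = block_diag R As in
     mat (dim_row A + dim_row B) (dim_col A + dim_col B)
       (\<lambda>(i, j). if i < dim_row A \<and> j < dim_col A then A $$ (i, j)
                 else if i < dim_row A \<or> j < dim_col A then \<zero>\<^bsub>R\<^esub>
                 else B $$ (i - dim_row A, j - dim_col A)))"


text \<open>An edge \<open>A = {a\<^sup>1, \<dots>, a\<^sup>k}\<close> with a chosen order of its vertices is the list of these vertices,
  and a hypergraph \<open>{A\<^sub>1, \<dots>, A\<^sub>n}\<close> is enumerated by a list of such lists.\<close>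

definition edge_enumeration :: "'a set set \<Rightarrow> 'a list list \<Rightarrow> bool" where
  "edge_enumeration \<Gamma> es \<longleftrightarrow>
     distinct (map set es) \<and> set ` set es = \<Gamma> \<and> (\<forall>a\<in>set es. distinct a)"

lemma edge_enumeration_exists:
  assumes "finite X" "hypergraph_on X \<Gamma>"
  shows "\<exists>es. edge_enumeration (k_section \<Gamma> k) es"
proof -
  have fin: "finite (k_section \<Gamma> k)" and finA: "\<And>A. A \<in> k_section \<Gamma> k \<Longrightarrow> finite A"
    using assms by (auto simp: hypergraph_on_def k_section_def intro: finite_subset[of _ "Pow X"] finite_subset[of _ X])
  obtain As where As: "set As = k_section \<Gamma> k" "distinct As"
    using finite_distinct_list[OF fin] by blast
  obtain l where l: "\<And>A. A \<in> k_section \<Gamma> k \<Longrightarrow> set (l A) = A \<and> distinct (l A)"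
    using finite_distinct_list[OF finA] by metis
  have "map (set \<circ> l) As = As"
    using l As by (intro map_idI) auto
  then have "edge_enumeration (k_section \<Gamma> k) (map l As)"
    using l As by (auto simp: edge_enumeration_def image_image)
  then show ?thesis by blast
qed

text \<open>The two-row array with upper row \<open>a\<close> and lower row \<open>b\<close> is the map \<^term>\<open>map_of (zip a b)\<close>. The sum runs over
  \<open>\<sigma>\<close>, and \<^term>\<open>permute_list \<sigma> b\<close> is the row \<open>b\<^bsup>\<sigma>(1)\<^esup> \<dots> b\<^bsup>\<sigma>(k)\<^esup>\<close>.\<close>

definition canonical_entry :: "'a set \<Rightarrow> 'a list \<Rightarrow> 'a list \<Rightarrow> ('a \<Rightarrow> 'a) set" where
  "canonical_entry X a b =
     (\<Oplus>\<^bsub>partials_ring X\<^esub> \<sigma> \<in> {\<sigma>. \<sigma> permutes {..<length a}}.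
        partial_class X (map_of (zip a (permute_list \<sigma> b))))"

lemma is_partial_array:
  assumes "distinct a" "distinct b" "length a = length b" "set a \<subseteq> X" "set b \<subseteq> X"
    and "\<sigma> permutes {..<length a}"
  shows "is_partial X (map_of (zip a (permute_list \<sigma> b)))"
proof -
  have s: "\<sigma> permutes {..<length b}" using assms by simp
  define c where "c = permute_list \<sigma> b"
  have c: "distinct c" "length a = length c" "set c \<subseteq> X"
    using assms s by (auto simp: c_def)
  have dom: "dom (map_of (zip a c)) = set a" and ran: "ran (map_of (zip a c)) = set c"
    using c assms(1) by (simp_all add: ran_map_of_zip)
  have nth: "map_of (zip a c) (a ! i) = Some (c ! i)" if "i < length a" for i
    using that c assms(1) by (simp add: map_of_zip_nth)
  have "inj_on (map_of (zip a c)) (set a)"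
    using c by (auto simp: inj_on_def in_set_conv_nth nth nth_eq_iff_index_eq)
  then show ?thesis
    using dom ran c assms(4) by (simp add: is_partial_def flip: c_def)
qed

definition homogeneous_canonical_matrix ::
    "'a set \<Rightarrow> 'a list list \<Rightarrow> ('a \<Rightarrow> 'a) set mat" where
  "homogeneous_canonical_matrix X es =
     mat (length es) (length es) (\<lambda>(i, j). canonical_entry X (es ! i) (es ! j))"

text \<open>Here \<open>E k\<close> is meant to be an enumeration of the \<open>k\<close>-section.\<close>

definition canonical_matrix ::
    "'a set \<Rightarrow> (nat \<Rightarrow> 'a list list) \<Rightarrow> ('a \<Rightarrow> 'a) set mat" where
  "canonical_matrix X E =
     block_diag (partials_ring X)
       (map (\<lambda>k. homogeneous_canonical_matrix X (E k)) [1..<Suc (card X)])"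

end

theory Submission
  imports Defs
begin

text \<open>
  Membership of a fixed permutation \<open>g\<close> in an element of \<open>\<Pi>(X)\<close> is a ring homomorphism from \<open>\<Pi>(X)\<close> to
  the field with two elements: \<open>g\<close> lies in a sum iff it lies in an odd number of the summands, and
  in a product iff it lies in all the factors. So \<open>g\<close> lies in the determinant iff an odd number of
  the permutations \<open>\<rho>\<close> of the row indices satisfy \<open>g \<in> M(i, \<rho>(i))\<close> for all \<open>i\<close>.

  Parity causes no loss, because the numbers to be counted are only ever 0 or 1. The reason is the
  same at two levels (lemma \<open>card_index_permutations\<close>): if an injective map \<open>h\<close> is to carry a
  list of distinct points to another one up to a rearrangement of indices, then the rearrangement
  is forced, and it exists iff \<open>h\<close> carries the one underlying set onto the other.

  Taking vertices as points, with \<open>h = g\<close>, this computes a single entry: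
  \<open>g\<close> lies in the entry of the edges \<open>A\<close> and \<open>B\<close> iff \<open>g(A) = B\<close>. Since permutations preserve
  cardinality, this description is also right for the zeros outside the diagonal blocks, so the
  block structure disappears: the canonical matrix has the entries \<open>{g. g(A\<^sub>i) = A\<^sub>j}\<close> for one
  enumeration \<open>A\<^sub>1, \<dots>, A\<^sub>n\<close> of all edges. Taking edges as points, with \<open>h\<close> the action of \<open>g\<close> on
  sets, the determinant then consists of the \<open>g\<close> that map \<open>\<Gamma>\<close> onto itself. As \<open>\<Gamma>\<close> is finite and
  \<open>g\<close> acts injectively on sets, mapping \<open>\<Gamma>\<close> into itself is enough.
\<close>

section \<open>Membership in sums, products and determinants\<close>

lemma carrier_partials_ring: "carrier (partials_ring X) = {A. \<forall>g\<in>A. g permutes X}"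
  by (auto simp: partials_ring_def)

lemma mem_finsum_partials_ring:
  assumes "finite I" "\<And>i. i \<in> I \<Longrightarrow> f i \<in> carrier (partials_ring X)"
  shows "g \<in> finsum (partials_ring X) f I \<longleftrightarrow> odd (card {i \<in> I. g \<in> f i})"
proof -
  interpret cring "partials_ring X" by (rule cring_partials_ring)
  show ?thesis
    using assms
  proof (induction I rule: finite_induct)
    case empty
    show ?case by (simp, simp add: partials_ring_def)
  next
    case (insert j I)
    have "{i \<in> insert j I. g \<in> f i} =
        (if g \<in> f j then insert j {i \<in> I. g \<in> f i} else {i \<in> I. g \<in> f i})"
      by auto
    moreover have "g \<in> finsum (partials_ring X) f (insert j I) \<longleftrightarrow>
        (g \<in> f j) \<noteq> (g \<in> finsum (partials_ring X) f I)"
      using insert by (subst finsum_insert) (auto simp: partials_ring_def)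
    ultimately show ?case
      using insert by simp
  qed
qed

lemma mem_finprod_partials_ring:
  assumes "finite I" "\<And>i. i \<in> I \<Longrightarrow> f i \<in> carrier (partials_ring X)"
  shows "g \<in> finprod (partials_ring X) f I \<longleftrightarrow> g permutes X \<and> (\<forall>i\<in>I. g \<in> f i)"
proof -
  interpret cring "partials_ring X" by (rule cring_partials_ring)
  show ?thesis
    using assms
  proof (induction I rule: finite_induct)
    case empty
    show ?case by (simp, simp add: partials_ring_def)
  next
    case (insert j I)
    have "g \<in> finprod (partials_ring X) f (insert j I) \<longleftrightarrow>
        g \<in> f j \<and> g \<in> finprod (partials_ring X) f I"
      using insert by (subst finprod_insert) (auto simp: partials_ring_def)
    then show ?case
      using insert by auto
  qed
qed

lemma mem_partials_det:
  assumes "\<And>i j. i < dim_row M \<Longrightarrow> j < dim_row M \<Longrightarrow> M $$ (i, j) \<in> carrier (partials_ring X)"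
  shows "g \<in> partials_det X M \<longleftrightarrow> g permutes X \<and>
    odd (card {\<rho>. \<rho> permutes {..<dim_row M} \<and> (\<forall>i<dim_row M. g \<in> M $$ (i, \<rho> i))})"
proof -
  interpret cring "partials_ring X" by (rule cring_partials_ring)
  define n where "n = dim_row M"
  define P where "P \<rho> = (\<Otimes>\<^bsub>partials_ring X\<^esub> i \<in> {..<n}. M $$ (i, \<rho> i))" for \<rho>
  have entry: "M $$ (i, \<rho> i) \<in> carrier (partials_ring X)" if "\<rho> permutes {..<n}" "i < n" for \<rho> i
    using assms that permutes_in_image[OF that(1), of i] by (simp add: n_def)
  have P: "g \<in> P \<rho> \<longleftrightarrow> g permutes X \<and> (\<forall>i<n. g \<in> M $$ (i, \<rho> i))" if "\<rho> permutes {..<n}" for \<rho>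
    unfolding P_def using entry[OF that] by (subst mem_finprod_partials_ring) auto
  have "P \<rho> \<in> carrier (partials_ring X)" if "\<rho> permutes {..<n}" for \<rho>
    unfolding P_def using entry[OF that] by (intro finprod_closed) auto
  then have "g \<in> partials_det X M \<longleftrightarrow> odd (card {\<rho> \<in> {\<rho>. \<rho> permutes {..<n}}. g \<in> P \<rho>})"
    unfolding partials_det_def n_def[symmetric] P_def[symmetric]
    by (intro mem_finsum_partials_ring) (auto simp: finite_permutations)
  also have "{\<rho> \<in> {\<rho>. \<rho> permutes {..<n}}. g \<in> P \<rho>} =
      (if g permutes X then {\<rho>. \<rho> permutes {..<n} \<and> (\<forall>i<n. g \<in> M $$ (i, \<rho> i))} else {})"
    using P by auto
  finally show ?thesis
    by (simp add: n_def split: if_splits)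
qed

section \<open>Counting forced rearrangements\<close>

text \<open>
  Distinctness of \<open>ys\<close> determines \<open>\<rho>(i)\<close> from \<open>h(x\<^sub>i)\<close>; distinctness of \<open>xs\<close> and injectivity of \<open>h\<close>
  make the map so determined a permutation.
\<close>

lemma card_index_permutations:
  assumes "distinct xs" "distinct ys" "length xs = n" "length ys = n" "inj_on h (set xs)"
  shows "card {\<rho>. \<rho> permutes {..<n} \<and> (\<forall>i<n. h (xs ! i) = ys ! \<rho> i)} =
    (if h ` set xs = set ys then 1 else 0)"
proof -
  let ?R = "{\<rho>. \<rho> permutes {..<n} \<and> (\<forall>i<n. h (xs ! i) = ys ! \<rho> i)}"
  have xs: "bij_betw ((!) xs) {..<n} (set xs)" and ys: "bij_betw ((!) ys) {..<n} (set ys)"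
    using assms by (auto intro: bij_betw_nth)
  have unique: "\<rho> = \<rho>'" if "\<rho> \<in> ?R" "\<rho>' \<in> ?R" for \<rho> \<rho>'
  proof
    fix i
    show "\<rho> i = \<rho>' i"
    proof (cases "i < n")
      case True
      then have "\<rho> i < n" "\<rho>' i < n" "ys ! \<rho> i = ys ! \<rho>' i"
        using that permutes_in_image[of \<rho> "{..<n}" i] permutes_in_image[of \<rho>' "{..<n}" i] by auto
      then show ?thesis
        using assms by (simp add: nth_eq_iff_index_eq)
    next
      case False
      then show ?thesis
        using that permutes_not_in[of \<rho> "{..<n}" i] permutes_not_in[of \<rho>' "{..<n}" i] by simp
    qed
  qed
  show ?thesis
  proof (cases "h ` set xs = set ys")
    case True
    define \<rho>\<^sub>0 where "\<rho>\<^sub>0 = the_inv_into {..<n} ((!) ys) \<circ> (h \<circ> (!) xs)"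
    \<comment> \<open>\<open>permutes\<close> asks for the identity outside the index range, where \<open>\<rho>\<^sub>0\<close> has junk values.\<close>
    define \<rho> where "\<rho> i = (if i < n then \<rho>\<^sub>0 i else i)" for i
    have "bij_betw h (set xs) (set ys)"
      using True assms(5) by (simp add: bij_betw_def)
    then have "bij_betw \<rho>\<^sub>0 {..<n} {..<n}"
      unfolding \<rho>\<^sub>0_def using bij_betw_the_inv_into[OF ys] xs by (blast intro: bij_betw_trans)
    then have "bij_betw \<rho> {..<n} {..<n}"
      by (rule bij_betw_cong[THEN iffD1, rotated]) (simp add: \<rho>_def)
    then have "\<rho> permutes {..<n}"
      by (rule bij_imp_permutes) (simp add: \<rho>_def)
    moreover have "h (xs ! i) = ys ! \<rho> i" if "i < n" for i
    proof -
      have "h (xs ! i) \<in> (!) ys ` {..<n}"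
        using that True assms(3) bij_betw_imp_surj_on[OF ys] by auto
      then show ?thesis
        using that f_the_inv_into_f[OF bij_betw_imp_inj_on[OF ys]] by (simp add: \<rho>_def \<rho>\<^sub>0_def)
    qed
    ultimately have "?R = {\<rho>}"
      using unique by blast
    then show ?thesis
      using True by simp
  next
    case False
    have "h ` set xs = set ys" if "\<rho> \<in> ?R" for \<rho>
    proof -
      have "h ` set xs = (\<lambda>i. h (xs ! i)) ` {..<n}"
        unfolding bij_betw_imp_surj_on[OF xs, symmetric] by (simp add: image_image)
      also have "\<dots> = (!) ys ` \<rho> ` {..<n}"
        using that by (simp add: image_image)
      also have "\<dots> = set ys"
        using that permutes_image[of \<rho>] bij_betw_imp_surj_on[OF ys] by simp
      finally show ?thesis .
    qed
    then have "?R = {}"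
      using False by blast
    then show ?thesis
      using False by (simp only: card.empty if_False)
  qed
qed

section \<open>The entries of the canonical matrix\<close>

text \<open>
  The arrays of an entry are pairwise incompatible, and together they allow \<open>g\<close> to send \<open>a\<close> to
  \<open>b\<close> in any order; hence the entry is their disjoint union.
\<close>

lemma canonical_entry_eq:
  assumes "distinct a" "distinct b" "length a = length b"
  shows "canonical_entry X a b = {g. g permutes X \<and> g ` set a = set b}"
proof (rule Set.set_eqI)
  fix g
  let ?n = "length a"
  let ?class = "\<lambda>\<sigma>. partial_class X (map_of (zip a (permute_list \<sigma> b)))"
  have cls: "g \<in> ?class \<sigma> \<longleftrightarrow> g permutes X \<and> (\<forall>i<?n. g (a ! i) = b ! \<sigma> i)"
    if "\<sigma> permutes {..<?n}" for \<sigma>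
  proof -
    have "dom (map_of (zip a (permute_list \<sigma> b))) = set a"
      using assms by simp
    moreover have "map_of (zip a (permute_list \<sigma> b)) (a ! i) = Some (b ! \<sigma> i)" if "i < ?n" for i
      using that \<open>\<sigma> permutes {..<?n}\<close> assms by (simp add: map_of_zip_nth permute_list_nth)
    ultimately show ?thesis
      by (auto simp: partial_class_def all_set_conv_all_nth)
  qed
  have "g \<in> canonical_entry X a b \<longleftrightarrow> odd (card {\<sigma> \<in> {\<sigma>. \<sigma> permutes {..<?n}}. g \<in> ?class \<sigma>})"
    unfolding canonical_entry_def
    by (intro mem_finsum_partials_ring)
      (auto simp: finite_permutations carrier_partials_ring partial_class_def)
  also have "{\<sigma> \<in> {\<sigma>. \<sigma> permutes {..<?n}}. g \<in> ?class \<sigma>} =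
      (if g permutes X then {\<sigma>. \<sigma> permutes {..<?n} \<and> (\<forall>i<?n. g (a ! i) = b ! \<sigma> i)} else {})"
    using cls by auto
  finally have "g \<in> canonical_entry X a b \<longleftrightarrow> g permutes X \<and>
      odd (card {\<sigma>. \<sigma> permutes {..<?n} \<and> (\<forall>i<?n. g (a ! i) = b ! \<sigma> i)})"
    by simp
  also have "\<dots> \<longleftrightarrow> g permutes X \<and> g ` set a = set b"
  proof (rule conj_cong[OF refl])
    assume "g permutes X"
    then have "inj_on g (set a)"
      by (rule permutes_inj_on)
    then have "card {\<sigma>. \<sigma> permutes {..<?n} \<and> (\<forall>i<?n. g (a ! i) = b ! \<sigma> i)} =
        (if g ` set a = set b then 1 else 0)"
      using assms by (intro card_index_permutations) simp_all
    then show "odd (card {\<sigma>. \<sigma> permutes {..<?n} \<and> (\<forall>i<?n. g (a ! i) = b ! \<sigma> i)}) \<longleftrightarrow> g ` set a = set b"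
      by (elim ssubst) simp
  qed
  finally show "g \<in> canonical_entry X a b \<longleftrightarrow> g \<in> {g. g permutes X \<and> g ` set a = set b}"
    by simp
qed

text \<open>
  The zeros between the blocks \<open>k \<noteq> l\<close> agree with the formula for the entries because no
  permutation maps a \<open>k\<close>-set onto an \<open>l\<close>-set.
\<close>

lemma block_diag_homogeneous_canonical_matrices:
  assumes "distinct ks"
    and "\<And>k a. k \<in> set ks \<Longrightarrow> a \<in> set (E k) \<Longrightarrow> distinct a \<and> length a = k"
  shows "block_diag (partials_ring X) (map (\<lambda>k. homogeneous_canonical_matrix X (E k)) ks) =
    (let es = concat (map E ks) in
      mat (length es) (length es)
        (\<lambda>(i, j). {g. g permutes X \<and> g ` set (es ! i) = set (es ! j)}))"
  using assms
proof (induction ks)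
  case Nil
  show ?case by (rule eq_matI) auto
next
  case (Cons k ks)
  define es where "es = concat (map E ks)"
  define S where "S a b = {g. g permutes X \<and> g ` set a = set b}" for a b
  have IH: "block_diag (partials_ring X) (map (\<lambda>k. homogeneous_canonical_matrix X (E k)) ks) =
      mat (length es) (length es) (\<lambda>(i, j). S (es ! i) (es ! j))"
    unfolding es_def S_def using Cons.prems by (intro Cons.IH[unfolded Let_def]) auto
  have block: "distinct a \<and> length a = k" if "a \<in> set (E k)" for a
    using Cons.prems(2)[of k a] that by simp
  have rest: "length b \<noteq> k" "distinct b" if b: "b \<in> set es" for b
  proof -
    obtain l where l: "l \<in> set ks" "b \<in> set (E l)"
      using b by (auto simp: es_def)
    then have "distinct b \<and> length b = l"
      using Cons.prems(2)[of l b] by simp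
    then show "length b \<noteq> k" "distinct b"
      using l(1) Cons.prems(1) by auto
  qed
  have on: "canonical_entry X a b = S a b" if "a \<in> set (E k)" "b \<in> set (E k)" for a b
    using block[OF that(1)] block[OF that(2)] by (simp add: canonical_entry_eq S_def)
  have off: "S a b = {}" "S b a = {}" if "a \<in> set (E k)" "b \<in> set es" for a b
  proof -
    have "card (set a) \<noteq> card (set b)"
      using block[OF that(1)] rest[OF that(2)] by (simp add: distinct_card)
    moreover have "card (g ` A) = card A" if "g permutes X" for g A
      using that by (intro card_image permutes_inj_on)
    ultimately show "S a b = {}" "S b a = {}"
      by (auto simp: S_def) metis+
  qed
  have entry: "(if i < length (E k) \<and> j < length (E k) then canonical_entry X (E k ! i) (E k ! j)
      else if i < length (E k) \<or> j < length (E k) then {}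
      else S (es ! (i - length (E k))) (es ! (j - length (E k)))) =
      S ((E k @ es) ! i) ((E k @ es) ! j)"
    if "i < length (E k) + length es" "j < length (E k) + length es" for i j
    using that by (cases "i < length (E k)"; cases "j < length (E k)")
      (simp_all add: nth_append on off less_diff_conv2)
  show ?case
    unfolding list.map block_diag.simps IH concat.simps es_def[symmetric] Let_def S_def[symmetric]
    by (rule eq_matI)
      (simp_all add: homogeneous_canonical_matrix_def entry[symmetric] partials_ring_def
        less_diff_conv2)
qed

section \<open>The determinant as automorphism group\<close>

theorem theorem5p2:
  fixes X :: "'a set" and \<Gamma> :: "'a set set" and E :: "nat \<Rightarrow> 'a list list"
  assumes "finite X"
    and "hypergraph_on X \<Gamma>"
    and "\<And>k. k \<in> {1..card X} \<Longrightarrow> edge_enumeration (k_section \<Gamma> k) (E k)"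
  shows "partials_det X (canonical_matrix X E) = hypergraph_aut X \<Gamma>"
proof (rule Set.set_eqI)
  fix g
  define ks where "ks = [1..<Suc (card X)]"
  define es where "es = concat (map E ks)"
  define n where "n = length es"
  let ?A = "map set es"
  let ?S = "\<lambda>i j. {g. g permutes X \<and> g ` set (es ! i) = set (es ! j)}"
  have inj_on_image: "inj_on ((`) g) B" if "g permutes X" for B
    using permutes_inj[OF that] by (simp add: inj_on_def inj_image_eq_iff)
  have distinct_ks: "distinct ks"
    by (simp only: ks_def distinct_upt)
  have E: "distinct (map set (E k))" "set ` set (E k) = k_section \<Gamma> k"
    "\<And>a. a \<in> set (E k) \<Longrightarrow> distinct a" if "k \<in> set ks" for k
    using assms(3)[of k] that by (simp_all add: ks_def edge_enumeration_def atLeastLessThanSuc_atLeastAtMost del: upt_Suc)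
  have len: "distinct a \<and> length a = k" if "k \<in> set ks" "a \<in> set (E k)" for k a
  proof -
    have "set a \<in> k_section \<Gamma> k"
      using E(2)[OF that(1)] that(2) by blast
    then show ?thesis
      using E(3)[OF that] by (simp add: k_section_def distinct_card)
  qed
  have M: "canonical_matrix X E = mat n n (\<lambda>(i, j). ?S i j)"
    using block_diag_homogeneous_canonical_matrices[of ks E X] len distinct_ks
    unfolding canonical_matrix_def ks_def[symmetric] es_def n_def Let_def by simp

  \<comment> \<open>The sections for sizes \<open>1, \<dots>, |X|\<close> exhaust \<open>\<Gamma>\<close> because edges are nonempty subsets of \<open>X\<close>.\<close>
  have "set ?A = (\<Union>k\<in>set ks. set ` set (E k))"
    by (auto simp: es_def)
  also have "\<dots> = (\<Union>k\<in>set ks. k_section \<Gamma> k)"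
    using E(2) by simp
  also have "\<dots> = \<Gamma>"
  proof -
    have "card A \<in> set ks" if "A \<in> \<Gamma>" for A
    proof -
      have "A \<subseteq> X" "A \<noteq> {}"
        using assms(2) that by (auto simp: hypergraph_on_def)
      then have "0 < card A" "card A \<le> card X"
        using assms(1) by (auto simp: card_gt_0_iff finite_subset card_mono)
      then show ?thesis
        by (simp add: ks_def less_Suc_eq_le del: upt_Suc)
    qed
    then show ?thesis
      by (auto simp: k_section_def)
  qed
  finally have edges: "set ?A = \<Gamma>" .
  \<comment> \<open>No edge is listed twice: edges from different sections differ in size.\<close>
  have "distinct ?A"
  proof -
    have "distinct (concat (map (\<lambda>k. map set (E k)) ls))" if "distinct ls" "set ls \<subseteq> set ks" for ls
      using that
    proof (induction ls)
      case (Cons k ls)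
      have "set ` set (E k) \<inter> set ` set (E l) = {}" if "l \<in> set ls" for l
      proof -
        have "k \<noteq> l" "k \<in> set ks" "l \<in> set ks"
          using Cons.prems that by auto
        then have "set ` set (E k) \<inter> set ` set (E l) = k_section \<Gamma> k \<inter> k_section \<Gamma> l"
          using E(2) by simp
        also have "\<dots> = {}"
          using \<open>k \<noteq> l\<close> by (auto simp: k_section_def)
        finally show ?thesis .
      qed
      then have "set (map set (E k)) \<inter> set (concat (map (\<lambda>k. map set (E k)) ls)) = {}"
        by (auto simp only: set_map set_concat image_comp comp_def)
      moreover have "distinct (map set (E k))"
        using Cons.prems E(1)[of k] by simp
      ultimately show ?case
        using Cons by simp
    qed simp
    from this[of ks] show ?thesis
      by (simp add: es_def map_concat comp_def distinct_ks)
  qed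

  have "g \<in> partials_det X (canonical_matrix X E) \<longleftrightarrow> g permutes X \<and>
      odd (card {\<rho>. \<rho> permutes {..<n} \<and> (\<forall>i<n. g \<in> canonical_matrix X E $$ (i, \<rho> i))})"
    using mem_partials_det[of "canonical_matrix X E" X g] by (simp add: M carrier_partials_ring)
  also have "\<dots> \<longleftrightarrow> g permutes X \<and>
      odd (card {\<rho>. \<rho> permutes {..<n} \<and> (\<forall>i<n. g ` (?A ! i) = ?A ! \<rho> i)})"
  proof (rule conj_cong[OF refl])
    assume g: "g permutes X"
    have "g \<in> canonical_matrix X E $$ (i, \<rho> i) \<longleftrightarrow> g ` (?A ! i) = ?A ! \<rho> i"
      if "\<rho> permutes {..<n}" "i < n" for \<rho> i
      using that g permutes_in_image[OF that(1), of i] by (simp add: M n_def)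
    then have "{\<rho>. \<rho> permutes {..<n} \<and> (\<forall>i<n. g \<in> canonical_matrix X E $$ (i, \<rho> i))} =
        {\<rho>. \<rho> permutes {..<n} \<and> (\<forall>i<n. g ` (?A ! i) = ?A ! \<rho> i)}"
      by blast
    then show "odd (card {\<rho>. \<rho> permutes {..<n} \<and> (\<forall>i<n. g \<in> canonical_matrix X E $$ (i, \<rho> i))}) \<longleftrightarrow>
        odd (card {\<rho>. \<rho> permutes {..<n} \<and> (\<forall>i<n. g ` (?A ! i) = ?A ! \<rho> i)})"
      by simp
  qed
  also have "\<dots> \<longleftrightarrow> g permutes X \<and> (`) g ` \<Gamma> = \<Gamma>"
  proof (rule conj_cong[OF refl])
    assume "g permutes X"
    then have "inj_on ((`) g) (set ?A)"
      by (rule inj_on_image)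
    then have "card {\<rho>. \<rho> permutes {..<n} \<and> (\<forall>i<n. g ` (?A ! i) = ?A ! \<rho> i)} =
        (if (`) g ` set ?A = set ?A then 1 else 0)"
      using \<open>distinct ?A\<close> by (intro card_index_permutations) (simp_all add: n_def)
    then show "odd (card {\<rho>. \<rho> permutes {..<n} \<and> (\<forall>i<n. g ` (?A ! i) = ?A ! \<rho> i)}) \<longleftrightarrow>
        (`) g ` \<Gamma> = \<Gamma>"
      unfolding edges by (elim ssubst) simp
  qed
  also have "\<dots> \<longleftrightarrow> g \<in> hypergraph_aut X \<Gamma>"
  proof -
    have "(`) g ` \<Gamma> = \<Gamma>" if "g permutes X" "\<forall>A\<in>\<Gamma>. g ` A \<in> \<Gamma>"
    proof (rule endo_inj_surj)
      show "finite \<Gamma>"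
        using edges by (metis List.finite_set)
      show "inj_on ((`) g) \<Gamma>"
        using that(1) by (rule inj_on_image)
    qed (use that(2) in blast)
    then show ?thesis
      by (auto simp: hypergraph_aut_def)
  qed
  finally show "g \<in> partials_det X (canonical_matrix X E) \<longleftrightarrow> g \<in> hypergraph_aut X \<Gamma>" .
qed

end
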